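(* Let $Q_1$ and $Q_2$ be CRPQs. Then $Q_1\subseteq_{q\text{-}inj}Q_2$ (i.e. $Q_1(G)^{q\text{-}inj}\subseteq Q_2(G)^{q\text{-}inj}$ for every graph database $G$) if and only if for every expansion $E_1\in\mathrm{Exp}(Q_1)$ there is an expansion $E_2\in\mathrm{Exp}(Q_2)$ such that $E_2\xrightarrow{inj}E_1$.
   Context: A graph database over a finite alphabet $\mathbb{A}$ is a finite edge-labeled directed graph $G=(V,E)$ with $E\subseteq V\times\mathbb{A}\times V$. A path from $u$ to $v$ is a sequence of edges $v_0\xrightarrow{a_1}v_1,\dots,v_{k-1}\xrightarrow{a_k}v_k$ of $G$ with $k\ge 0$, $u=v_0$, $v=v_k$; its label is $a_1\cdots a_k$; its internal nodes are the $v_i$ with $0<i<k$. It is a simple path if all $v_i$ are pairwise distinct, and a simple cycle if $v_0=v_k$ and $v_0,\dots,v_{k-1}$ are pairwise distinct. A conjunctive regular path query (CRPQ) over $\mathbb{A}$ is an expression $Q(\bar z)=A_1\wedge\dots\wedge A_m$ ($m\ge 0$), where each atom $A_i$ has the form $x_i\xrightarrow{L_i}y_i$ with $x_i,y_i$ variables (possibly equal) and $L_i$ a regular expression over $\mathbb{A}$, and $\bar z$ is a tuple of (not necessarily distinct) free variables; $\mathrm{vars}(Q)$ is its set of variables (including the free ones). A conjunctive query (CQ) is a CRPQ in which every $L_i$ is a single letter; a CQ is identified with the graph database whose vertices are its variables and whose edges are its atoms. Query-injective semantics. If no $L_i$ contains the empty word $\epsilon$, then $Q(G)^{q\text{-}inj}$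 is the set of tuples $\bar v$ for which there is an injective map $\mu:\mathrm{vars}(Q)\to V$ with $\mu(\bar z)=\bar v$ and, for each $i$, a path $\pi_i$ from $\mu(x_i)$ to $\mu(y_i)$ in $G$ with label in $L_i$, which is a simple path if $x_i\ne y_i$ and a simple cycle if $x_i=y_i$, such that for all $i\neq j$ no internal node of $\pi_i$ occurs in $\pi_j$, and no internal node of any $\pi_i$ is of the form $\mu(x)$ with $x\in\mathrm{vars}(Q)$. If $Q(\bar z)=x\xrightarrow{L}y\wedge Q'$ with $\epsilon\in L$, then $Q(G)^{q\text{-}inj}$ is (recursively) the union of the evaluation of $x\xrightarrow{L\setminus\{\epsilon\}}y\wedge Q'$ with free tuple $\bar z$ and the evaluation of $Q'[x/y]$ with free tuple $\bar z[x/y]$, where $[x/y]$ replaces every occurrence of $x$ by $y$; the variable $y$ is kept as a variable of the resulting query even if it no longer occurs in any atom. Homomorphisms. A homomorphism from a CQ $P(\bar x)$ to $(G,\bar v)$ is a map $h:\mathrm{vars}(P)\to V$ with $h(\bar x)=\bar v$ such that $h(x)\xrightarrow{a}h(y)$ is an edge of $G$ for each atom $x\xrightarrow{a}y$ of $P$. For CQs $P(\bar x)$, $P'(\bar x')$, write $P\xrightarrow{inj}P'$ if there is an injective homomorphism from $P$ to $(P',\bar x')$, with $P'$ seen as a graph database. Expansions. For an atom $x\xrightarrow{L}y$ and $w=a_1\cdots a_k\in L$, the $w$-expansion is the conjunction $x\xrightarrow{a_1}z_1\wedge z_1\xrightarrow{a_2}z_2\wedge\dots\wedge z_{k-1}\xrightarrow{a_k}y$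 with fresh variables $z_i$ if $w\ne\epsilon$, and the equality atom $x=y$ if $w=\epsilon$. An expansion profile $\varphi$ of $Q(\bar x)=A_1\wedge\dots\wedge A_m$ maps each atom $A_i$ to a $w$-expansion of it for some $w$ in its language. The expansion produced by $\varphi$ is the CQ obtained from $\widetilde E(\bar x)=\varphi(A_1)\wedge\dots\wedge\varphi(A_m)$ by collapsing each class of the equivalence relation on variables generated by the equality atoms into a single variable (also in the free tuple). $\mathrm{Exp}(Q)$ is the set of all expansions of $Q$. *)

theory Defs
  imports Main "HOL-Library.Infinite_Typeclass"
begin

section \<open>Regular expressions\<close>

datatype 'a rexp =
    Zero
  | One
  | Letter 'a
  | Plus "'a rexp" "'a rexp"
  | Times "'a rexp" "'a rexp"
  | Star "'a rexp"

primrec lang :: "'a rexp \<Rightarrow> 'a list set" where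
  "lang Zero = {}"
| "lang One = {[]}"
| "lang (Letter a) = {[a]}"
| "lang (Plus r s) = lang r \<union> lang s"
| "lang (Times r s) = {u @ v | u v. u \<in> lang r \<and> v \<in> lang s}"
| "lang (Star r) = {concat us | us. set us \<subseteq> lang r}"


section \<open>Graph databases and paths\<close>

record ('n, 'a) graph_db =
  nodes :: "'n set"
  edges :: "('n \<times> 'a \<times> 'n) set"

definition wf_graph_db :: "('n, 'a) graph_db \<Rightarrow> bool" where
  "wf_graph_db G \<longleftrightarrow> finite (nodes G) \<and> edges G \<subseteq> nodes G \<times> UNIV \<times> nodes G"

text \<open>A path \<open>v\<^sub>0 \<rightarrow> \<dots> \<rightarrow> v\<^sub>k\<close> is given by its node sequence \<open>p = [v\<^sub>0, \<dots>, v\<^sub>k]\<close> and its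
  label \<open>w\<close> of length \<open>k\<close>.\<close>

definition is_path :: "('n, 'a) graph_db \<Rightarrow> 'n \<Rightarrow> 'n list \<Rightarrow> 'a list \<Rightarrow> 'n \<Rightarrow> bool" where
  "is_path G u p w v \<longleftrightarrow>
     length p = Suc (length w) \<and> p ! 0 = u \<and> p ! length w = v \<and> set p \<subseteq> nodes G \<and>
     (\<forall>i < length w. (p ! i, w ! i, p ! Suc i) \<in> edges G)"

definition simple_path :: "'n list \<Rightarrow> bool" where
  "simple_path p \<longleftrightarrow> distinct p"

definition simple_cycle :: "'n list \<Rightarrow> bool" where
  "simple_cycle p \<longleftrightarrow> hd p = last p \<and> distinct (butlast p)"

definition internal_nodes :: "'n list \<Rightarrow> 'n set" where
  "internal_nodes p = {p ! i | i. 0 < i \<and> Suc i < length p}"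


section \<open>Queries\<close>

text \<open>One record serves for CRPQs (labels of type \<open>'a rexp\<close>), for CQs (labels of type \<open>'a\<close>), and
  for the queries arising in the evaluation of CRPQs (labels of type \<open>'a list set\<close>).
  The variable set is a separate component because eliminating an atom by identifying its two
  variables may leave a variable that occurs neither in an atom nor in the free tuple, and that
  variable must be kept.\<close>

record ('v, 'l) query =
  qvars :: "'v set"
  atoms :: "('v \<times> 'l \<times> 'v) list"
  free :: "'v list"

definition map_query :: "('v \<Rightarrow> 'w) \<Rightarrow> ('l \<Rightarrow> 'm) \<Rightarrow> ('v, 'l) query \<Rightarrow> ('w, 'm) query" where
  "map_query f g Q =
     \<lparr>qvars = f ` qvars Q,
      atoms = map (\<lambda>(x, l, y). (f x, g l, f y)) (atoms Q),
      free = map f (free Q)\<rparr>"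

text \<open>A CRPQ as written has no variables besides those of its atoms and its free tuple.\<close>

definition crpq :: "('v, 'a rexp) query \<Rightarrow> bool" where
  "crpq Q \<longleftrightarrow> qvars Q = (\<Union>(x, r, y) \<in> set (atoms Q). {x, y}) \<union> set (free Q)"


section \<open>Query-injective semantics\<close>

definition qinj_match ::
    "('n, 'a) graph_db \<Rightarrow> ('v, 'a list set) query \<Rightarrow> 'n list \<Rightarrow> bool" where
  "qinj_match G Q vs \<longleftrightarrow>
     (\<exists>\<mu> p w. let m = length (atoms Q) in
        inj_on \<mu> (qvars Q) \<and> \<mu> ` qvars Q \<subseteq> nodes G \<and> map \<mu> (free Q) = vs \<and>
        (\<forall>i < m. case atoms Q ! i of (x, L, y) \<Rightarrow>
           w i \<in> L \<and> is_path G (\<mu> x) (p i) (w i) (\<mu> y) \<and>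
           (if x = y then simple_cycle (p i) else simple_path (p i))) \<and>
        (\<forall>i < m. \<forall>j < m. i \<noteq> j \<longrightarrow> internal_nodes (p i) \<inter> set (p j) = {}) \<and>
        (\<forall>i < m. internal_nodes (p i) \<inter> \<mu> ` qvars Q = {}))"

text \<open>As conjunctions are unordered, the two recursive rules apply to any atom whose language
  contains the empty word. The substitution is applied to the whole variable set, which contains
  both \<open>x\<close> and \<open>y\<close>, so \<open>y\<close> always remains a variable.\<close>

inductive qinj_sem :: "('n, 'a) graph_db \<Rightarrow> ('v, 'a list set) query \<Rightarrow> 'n list \<Rightarrow> bool"
  for G :: "('n, 'a) graph_db" where
  no_eps: "\<lbrakk>\<forall>(x, L, y) \<in> set (atoms Q). [] \<notin> L; qinj_match G Q vs\<rbrakk> \<Longrightarrow> qinj_sem G Q vs"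
| remove_eps: "\<lbrakk>atoms Q = As @ (x, L, y) # Bs; [] \<in> L;
     qinj_sem G (Q\<lparr>atoms := As @ (x, L - {[]}, y) # Bs\<rparr>) vs\<rbrakk> \<Longrightarrow> qinj_sem G Q vs"
| identify: "\<lbrakk>atoms Q = As @ (x, L, y) # Bs; [] \<in> L;
     qinj_sem G (map_query (id(x := y)) id (Q\<lparr>atoms := As @ Bs\<rparr>)) vs\<rbrakk> \<Longrightarrow> qinj_sem G Q vs"

definition qinj_eval :: "('v, 'a rexp) query \<Rightarrow> ('n, 'a) graph_db \<Rightarrow> 'n list set" where
  "qinj_eval Q G = {vs. qinj_sem G (map_query id lang Q) vs}"


section \<open>Homomorphisms between conjunctive queries\<close>

definition graph_of :: "('v, 'a) query \<Rightarrow> ('v, 'a) graph_db" where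
  "graph_of P = \<lparr>nodes = qvars P, edges = set (atoms P)\<rparr>"

definition is_hom ::
    "('v \<Rightarrow> 'n) \<Rightarrow> ('v, 'a) query \<Rightarrow> ('n, 'a) graph_db \<Rightarrow> 'n list \<Rightarrow> bool" where
  "is_hom h P G vs \<longleftrightarrow>
     h ` qvars P \<subseteq> nodes G \<and> map h (free P) = vs \<and>
     (\<forall>(x, a, y) \<in> set (atoms P). (h x, a, h y) \<in> edges G)"

definition inj_hom :: "('v, 'a) query \<Rightarrow> ('w, 'a) query \<Rightarrow> bool" where
  "inj_hom P P' \<longleftrightarrow> (\<exists>h. is_hom h P (graph_of P') (free P') \<and> inj_on h (qvars P))"


section \<open>Expansions\<close>

text \<open>\<open>Fresh i j\<close> is the \<open>j\<close>-th fresh variable introduced for the \<open>i\<close>-th atom of the query.\<close>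

datatype 'v evar = Orig 'v | Fresh nat nat

text \<open>The \<open>j\<close>-th variable on the \<open>w\<close>-expansion of the \<open>i\<close>-th atom, from \<open>x\<close> to \<open>y\<close>, where \<open>w\<close> has
  length \<open>k\<close>.\<close>

definition exp_var :: "nat \<Rightarrow> 'v \<Rightarrow> 'v \<Rightarrow> nat \<Rightarrow> nat \<Rightarrow> 'v evar" where
  "exp_var i x y k j = (if j = 0 then Orig x else if j = k then Orig y else Fresh i j)"

definition word_expansion ::
    "nat \<Rightarrow> 'v \<Rightarrow> 'v \<Rightarrow> 'a list \<Rightarrow> ('v evar \<times> 'a \<times> 'v evar) list" where
  "word_expansion i x y w =
     map (\<lambda>j. (exp_var i x y (length w) j, w ! j, exp_var i x y (length w) (Suc j)))
       [0..<length w]"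

text \<open>Up to the names of the fresh variables, an expansion profile is a choice \<open>ws\<close> of one word
  per atom.\<close>

definition expansion_profile :: "('v, 'a rexp) query \<Rightarrow> 'a list list \<Rightarrow> bool" where
  "expansion_profile Q ws \<longleftrightarrow> list_all2 (\<lambda>(x, r, y) w. w \<in> lang r) (atoms Q) ws"

text \<open>The expansion before collapsing consists of \<open>pre_expansion\<close>, which has no atom for the
  empty words, together with the equality atoms \<open>eq_atoms\<close>.\<close>

definition pre_expansion :: "('v, 'a rexp) query \<Rightarrow> 'a list list \<Rightarrow> ('v evar, 'a) query" where
  "pre_expansion Q ws =
     \<lparr>qvars = Orig ` qvars Q \<union>
        {Fresh i j | i j. i < length (atoms Q) \<and> 0 < j \<and> j < length (ws ! i)},
      atoms = concat (map (\<lambda>i. case atoms Q ! i of (x, r, y) \<Rightarrow> word_expansion i x y (ws ! i))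
        [0..<length (atoms Q)]),
      free = map Orig (free Q)\<rparr>"

definition eq_atoms :: "('v, 'a rexp) query \<Rightarrow> 'a list list \<Rightarrow> 'v evar rel" where
  "eq_atoms Q ws =
     {(Orig x, Orig y) | x y. \<exists>i r. i < length (atoms Q) \<and> atoms Q ! i = (x, r, y) \<and> ws ! i = []}"

text \<open>The variable representing a class of the equivalence relation generated by \<open>R\<close> is the class
  itself.\<close>

definition collapse :: "'v rel \<Rightarrow> ('v, 'a) query \<Rightarrow> ('v set, 'a) query" where
  "collapse R P = map_query (\<lambda>v. (R \<union> R\<inverse>)\<^sup>* `` {v}) id P"

definition Exp :: "('v, 'a rexp) query \<Rightarrow> ('v evar set, 'a) query set" where
  "Exp Q = {collapse (eq_atoms Q ws) (pre_expansion Q ws) | ws. expansion_profile Q ws}"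


section \<open>Containment\<close>

text \<open>Nodes are drawn from an infinite type, which contains a copy of every finite graph.\<close>

definition qinj_contained ::
    "'n::infinite itself \<Rightarrow> ('v, 'a rexp) query \<Rightarrow> ('v, 'a rexp) query \<Rightarrow> bool" where
  "qinj_contained _ Q\<^sub>1 Q\<^sub>2 \<longleftrightarrow>
     (\<forall>G :: ('n, 'a) graph_db. wf_graph_db G \<longrightarrow> qinj_eval Q\<^sub>1 G \<subseteq> qinj_eval Q\<^sub>2 G)"

end

theory Submission
  imports Defs
begin

text \<open>A tuple is in the query-injective evaluation of \<open>Q\<close> on \<open>G\<close> if and only if some expansion of
  \<open>Q\<close> maps homomorphically and injectively to \<open>G\<close> with that tuple as image of the free one: the
  atoms matched by \<open>\<epsilon>\<close> are the equality atoms of the expansion, the fresh variables are the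
  internal nodes of the witnessing paths, and the disjointness conditions on the paths together
  say that the map is injective. Containment from the condition on expansions then follows by
  composing homomorphisms; for the converse, evaluate both queries on an isomorphic copy of
  \<open>E\<^sub>1\<close>, where the identity puts the free tuple in the answer of \<open>Q\<^sub>1\<close>.\<close>

section \<open>Generated equivalence relations and homomorphisms out of a collapsed query\<close>

abbreviation equiv_closure :: "'b rel \<Rightarrow> 'b rel" where
  "equiv_closure R \<equiv> (R \<union> R\<inverse>)\<^sup>*"

lemma equiv_closure_sym: "(a, b) \<in> equiv_closure R \<Longrightarrow> (b, a) \<in> equiv_closure R"
  by (meson sym_Un_converse sym_rtrancl symD)

lemma equiv_closure_map:
  assumes "\<And>a b. (a, b) \<in> R \<Longrightarrow> (f a, f b) \<in> equiv_closure S"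
    and "(a, b) \<in> equiv_closure R"
  shows "(f a, f b) \<in> equiv_closure S"
  using assms(2)
proof (induction rule: rtrancl_induct)
  case (step b c)
  then have "(f b, f c) \<in> equiv_closure S"
    using assms(1) equiv_closure_sym by (metis UnE converseD)
  with step.IH show ?case by (rule rtrancl_trans)
qed simp

lemma equiv_closure_class_eq_iff:
  "equiv_closure R `` {u} = equiv_closure R `` {v} \<longleftrightarrow> (u, v) \<in> equiv_closure R"
proof
  assume "equiv_closure R `` {u} = equiv_closure R `` {v}"
  then show "(u, v) \<in> equiv_closure R"
    by (metis Image_singleton_iff equiv_closure_sym rtrancl.rtrancl_refl)
next
  assume "(u, v) \<in> equiv_closure R"
  then show "equiv_closure R `` {u} = equiv_closure R `` {v}"
    by (auto intro: rtrancl_trans dest: equiv_closure_sym)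
qed

text \<open>Universal property of the quotient: maps on classes correspond to maps \<open>h\<close>
  that respect \<open>R\<close>, and injectivity on classes says that \<open>h\<close> identifies no
  variables beyond those \<open>R\<close> forces together. This allows all later work to be done on
  \<open>pre_expansion\<close>, without handling classes.\<close>

lemma inj_hom_collapse_iff:
  "(\<exists>g. is_hom g (collapse R P) G vs \<and> inj_on g (qvars (collapse R P))) \<longleftrightarrow>
   (\<exists>h. is_hom h P G vs \<and> (\<forall>(u, v) \<in> R. h u = h v) \<and>
     (\<forall>u \<in> qvars P. \<forall>v \<in> qvars P. h u = h v \<longrightarrow> (u, v) \<in> equiv_closure R))"
  (is "?L \<longleftrightarrow> ?R")
proof
  let ?c = "\<lambda>v. equiv_closure R `` {v}"
  assume ?L
  then obtain g where g: "is_hom g (collapse R P) G vs" "inj_on g (qvars (collapse R P))"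
    by blast
  have "is_hom (g \<circ> ?c) P G vs"
    using g(1) by (fastforce simp: is_hom_def collapse_def map_query_def)
  moreover have "(g \<circ> ?c) u = (g \<circ> ?c) v" if "(u, v) \<in> R" for u v
  proof -
    have "?c u = ?c v"
      unfolding equiv_closure_class_eq_iff using that by blast
    then show ?thesis by simp
  qed
  moreover have "(u, v) \<in> equiv_closure R"
    if "u \<in> qvars P" "v \<in> qvars P" "(g \<circ> ?c) u = (g \<circ> ?c) v" for u v
  proof -
    have "?c u = ?c v"
      using g(2) that by (auto simp: collapse_def map_query_def dest: inj_onD)
    then show ?thesis unfolding equiv_closure_class_eq_iff .
  qed
  ultimately show ?R by blast
next
  let ?c = "\<lambda>v. equiv_closure R `` {v}"
  assume ?R
  then obtain h where h: "is_hom h P G vs" "\<And>u v. (u, v) \<in> R \<Longrightarrow> h u = h v"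
      "\<And>u v. u \<in> qvars P \<Longrightarrow> v \<in> qvars P \<Longrightarrow> h u = h v \<Longrightarrow> (u, v) \<in> equiv_closure R"
    by blast
  \<comment> \<open>The representative is arbitrary, because \<open>h\<close> is constant on each
    class.\<close>
  define g where "g S = h (SOME v. v \<in> S)" for S
  have h_closed: "h u = h v" if "(u, v) \<in> equiv_closure R" for u v
    using that by (induction rule: rtrancl_induct) (auto dest: h(2))
  have g_class: "g (?c v) = h v" for v
  proof -
    have "(SOME u. u \<in> ?c v) \<in> ?c v" by (rule someI[of _ v]) simp
    then show ?thesis unfolding g_def using h_closed by (metis Image_singleton_iff)
  qed
  have "is_hom g (collapse R P) G vs"
    using h(1) by (fastforce simp: is_hom_def collapse_def map_query_def g_class)
  moreover have "inj_on g (qvars (collapse R P))"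
    by (auto simp: collapse_def map_query_def inj_on_def g_class equiv_closure_class_eq_iff 
        simp del: Image_singleton_iff intro!: h(3))
  ultimately show ?L by blast
qed


section \<open>Matches along chosen words\<close>

text \<open>Inclusion instead of the equality in \<open>crpq\<close>: identifying variables may
  leave one that occurs nowhere, so only the inclusion survives the recursion of the
  semantics.\<close>

definition wf_query :: "('v, 'l) query \<Rightarrow> bool" where
  "wf_query Q \<longleftrightarrow>
     (\<forall>(x, l, y) \<in> set (atoms Q). x \<in> qvars Q \<and> y \<in> qvars Q) \<and> set (free Q) \<subseteq> qvars Q"

lemma wf_query_map_query: "wf_query Q \<Longrightarrow> wf_query (map_query f g Q)"
  by (auto simp: wf_query_def map_query_def case_prod_unfold)

text \<open>The counterpart of \<open>eq_atoms\<close> on the original variables. It is computed on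
  lists, so that it splits along an append when one atom is changed or removed.\<close>

definition eps_pairs :: "('v \<times> 'l \<times> 'v) list \<Rightarrow> 'a list list \<Rightarrow> 'v rel" where
  "eps_pairs As ws = {(x, y). \<exists>l. ((x, l, y), []) \<in> set (zip As ws)}"

text \<open>The choice between cycle and path compares the images, not the variables: the empty
  words of other atoms may identify \<open>x\<close> and \<open>y\<close>, which turns this atom
  into a loop of the query that is finally matched. A one-node path passes both tests.\<close>

definition realizes ::
    "('n, 'a) graph_db \<Rightarrow> ('v \<Rightarrow> 'n) \<Rightarrow> 'v \<times> 'a list set \<times> 'v \<Rightarrow> 'n list \<times> 'a list \<Rightarrow> bool" where
  "realizes G \<nu> = (\<lambda>(x, L, y) (p, w). w \<in> L \<and> is_path G (\<nu> x) p w (\<nu> y) \<and>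
     (if \<nu> x = \<nu> y then simple_cycle p else simple_path p))"

text \<open>Both directions are included because \<open>sorted_wrt\<close> only compares earlier
  entries with later ones.\<close>

definition independent :: "'n list \<times> 'a list \<Rightarrow> 'n list \<times> 'a list \<Rightarrow> bool" where
  "independent = (\<lambda>(p, _) (q, _).
     internal_nodes p \<inter> set q = {} \<and> internal_nodes q \<inter> set p = {})"

text \<open>Empty words stay in place as one-node paths, which are independent of every other path, and
  instead of being injective \<open>\<nu>\<close> identifies exactly the variables that the empty words equate.\<close>

definition word_match ::
    "('n, 'a) graph_db \<Rightarrow> ('v, 'a list set) query \<Rightarrow> 'n list \<Rightarrow> ('v \<Rightarrow> 'n) \<Rightarrow>
     ('n list \<times> 'a list) list \<Rightarrow> bool" where
  "word_match G Q vs \<nu> pws \<longleftrightarrow>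
     \<nu> ` qvars Q \<subseteq> nodes G \<and> map \<nu> (free Q) = vs \<and>
     list_all2 (realizes G \<nu>) (atoms Q) pws \<and> sorted_wrt independent pws \<and>
     (\<forall>(p, w) \<in> set pws. internal_nodes p \<inter> \<nu> ` qvars Q = {}) \<and>
     (\<forall>x \<in> qvars Q. \<forall>y \<in> qvars Q. \<nu> x = \<nu> y \<longrightarrow>
        (x, y) \<in> equiv_closure (eps_pairs (atoms Q) (map snd pws)))"

lemma is_path_Nil: "is_path G u p [] v \<longleftrightarrow> p = [u] \<and> u = v \<and> u \<in> nodes G"
  by (auto simp: is_path_def length_Suc_conv)

lemma is_path_hd_last:
  assumes "is_path G u p w v"
  shows "hd p = u" "last p = v"
proof -
  have "p \<noteq> []" "length p - 1 = length w" "p ! 0 = u" "p ! length w = v"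
    using assms by (auto simp: is_path_def)
  then show "hd p = u" "last p = v"
    by (simp_all add: hd_conv_nth last_conv_nth)
qed

lemma internal_nodes_singleton [simp]: "internal_nodes [v] = {}"
  by (auto simp: internal_nodes_def)

lemma eps_pairs_append:
  "length As = length ws \<Longrightarrow>
    eps_pairs (As @ Bs) (ws @ ws') = eps_pairs As ws \<union> eps_pairs Bs ws'"
  by (auto simp: eps_pairs_def)

lemma eps_pairs_Cons:
  "eps_pairs ((x, l, y) # As) (w # ws) = (if w = [] then {(x, y)} else {}) \<union> eps_pairs As ws"
  by (auto simp: eps_pairs_def)

lemma eps_pairs_map:
  "eps_pairs (map (\<lambda>(x, l, y). (f x, g l, f y)) As) ws = map_prod f f ` eps_pairs As ws"
proof (intro equalityI subrelI)
  fix u v assume "(u, v) \<in> eps_pairs (map (\<lambda>(x, l, y). (f x, g l, f y)) As) ws"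
  then show "(u, v) \<in> map_prod f f ` eps_pairs As ws"
    by (auto simp: eps_pairs_def zip_map1)
next
  fix u v assume "(u, v) \<in> map_prod f f ` eps_pairs As ws"
  then obtain x y l where "((x, l, y), []) \<in> set (zip As ws)" "u = f x" "v = f y"
    by (auto simp: eps_pairs_def)
  then have "((u, g l, v), []) \<in> set (zip (map (\<lambda>(x, l, y). (f x, g l, f y)) As) ws)"
    by (force simp: zip_map1)
  then show "(u, v) \<in> eps_pairs (map (\<lambda>(x, l, y). (f x, g l, f y)) As) ws"
    unfolding eps_pairs_def by blast
qed

lemma list_all2_realizes_map:
  "list_all2 (realizes G \<nu>) (map (\<lambda>(x, L, y). (f x, L, f y)) As) pws \<longleftrightarrow>
   list_all2 (realizes G (\<nu> \<circ> f)) As pws"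
  by (simp add: list_all2_map1 realizes_def case_prod_unfold)

lemma sorted_wrt_independentD:
  assumes "sorted_wrt independent pws" "i < length pws" "j < length pws" "i \<noteq> j"
  shows "internal_nodes (fst (pws ! i)) \<inter> set (fst (pws ! j)) = {}"
proof (cases "i < j")
  case True
  then have "independent (pws ! i) (pws ! j)"
    using assms by (simp add: sorted_wrt_iff_nth_less)
  then show ?thesis by (simp add: independent_def case_prod_unfold)
next
  case False
  then have "independent (pws ! j) (pws ! i)"
    using assms by (simp add: sorted_wrt_iff_nth_less)
  then show ?thesis by (simp add: independent_def case_prod_unfold)
qed

text \<open>An injective \<mu> has trivial kernel, which lies in every equivalence closure, and it
  makes comparing endpoints the same as comparing their images.\<close>

lemma word_match_if_qinj_match:
  assumes "wf_query Q" "qinj_match G Q vs"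
  shows "\<exists>\<nu> pws. word_match G Q vs \<nu> pws"
proof -
  obtain \<mu> p w where m: "inj_on \<mu> (qvars Q)" "\<mu> ` qvars Q \<subseteq> nodes G" "map \<mu> (free Q) = vs"
    "\<forall>i < length (atoms Q). case atoms Q ! i of (x, L, y) \<Rightarrow>
           w i \<in> L \<and> is_path G (\<mu> x) (p i) (w i) (\<mu> y) \<and>
           (if x = y then simple_cycle (p i) else simple_path (p i))"
    "\<forall>i < length (atoms Q). \<forall>j < length (atoms Q).
       i \<noteq> j \<longrightarrow> internal_nodes (p i) \<inter> set (p j) = {}"
    "\<forall>i < length (atoms Q). internal_nodes (p i) \<inter> \<mu> ` qvars Q = {}"
    using assms(2) unfolding qinj_match_def Let_def by blast
  let ?pws = "map (\<lambda>i. (p i, w i)) [0..<length (atoms Q)]"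
  have "list_all2 (realizes G \<mu>) (atoms Q) ?pws"
  proof (rule list_all2_all_nthI)
    fix i assume i: "i < length (atoms Q)"
    obtain x L y where a: "atoms Q ! i = (x, L, y)" by (metis prod_cases3)
    then have "x \<in> qvars Q" "y \<in> qvars Q"
      using assms(1) i by (force simp: wf_query_def dest: nth_mem)+
    then have "\<mu> x = \<mu> y \<longleftrightarrow> x = y" using m(1) by (auto dest: inj_onD)
    then show "realizes G \<mu> (atoms Q ! i) (?pws ! i)"
      using m(4) i a by (auto simp: realizes_def)
  qed simp
  moreover have "sorted_wrt independent ?pws"
    using m(5) by (auto simp: sorted_wrt_iff_nth_less independent_def)
  ultimately have "word_match G Q vs \<mu> ?pws"
    using m(1-3,6) by (auto simp: word_match_def dest: inj_onD)
  then show ?thesis by blast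
qed

text \<open>Without empty words there are no generating pairs, so the kernel condition of
  \<open>word_match\<close> becomes injectivity of \<nu>.\<close>

lemma qinj_match_if_word_match:
  assumes "wf_query Q" "\<forall>(x, L, y) \<in> set (atoms Q). [] \<notin> L" "word_match G Q vs \<nu> pws"
  shows "qinj_match G Q vs"
proof -
  note m = assms(3)[unfolded word_match_def]
  have len: "length pws = length (atoms Q)"
    using m by (auto dest: list_all2_lengthD)
  have r: "realizes G \<nu> (atoms Q ! i) (pws ! i)" if "i < length (atoms Q)" for i
    using m that by (auto dest: list_all2_nthD)
  have "eps_pairs (atoms Q) (map snd pws) = {}"
  proof -
    have False if z: "((x, L, y), []) \<in> set (zip (atoms Q) (map snd pws))" for x L y
    proof -
      obtain i where "i < length (atoms Q)" "atoms Q ! i = (x, L, y)" "snd (pws ! i) = []"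
        using z len by (auto simp: in_set_zip)
      moreover from this have "[] \<notin> L" using assms(2) by (metis case_prodD nth_mem)
      ultimately show False using r[of i] by (simp add: realizes_def split_beta)
    qed
    then show ?thesis by (auto simp: eps_pairs_def)
  qed
  then have inj: "inj_on \<nu> (qvars Q)"
    using m by (auto simp: inj_on_def)
  have "case atoms Q ! i of (x, L, y) \<Rightarrow>
           snd (pws ! i) \<in> L \<and> is_path G (\<nu> x) (fst (pws ! i)) (snd (pws ! i)) (\<nu> y) \<and>
           (if x = y then simple_cycle (fst (pws ! i)) else simple_path (fst (pws ! i)))"
    if i: "i < length (atoms Q)" for i
  proof -
    obtain x L y where a: "atoms Q ! i = (x, L, y)" by (metis prod_cases3)
    then have "x \<in> qvars Q" "y \<in> qvars Q"
      using assms(1) i by (force simp: wf_query_def dest: nth_mem)+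
    then have "\<nu> x = \<nu> y \<longleftrightarrow> x = y" using inj by (auto dest: inj_onD)
    then show ?thesis using r[OF i] a by (auto simp: realizes_def split_beta)
  qed
  moreover have "internal_nodes (fst (pws ! i)) \<inter> set (fst (pws ! j)) = {}"
    if "i < length (atoms Q)" "j < length (atoms Q)" "i \<noteq> j" for i j
    using m that len by (intro sorted_wrt_independentD) auto
  moreover have "internal_nodes (fst (pws ! i)) \<inter> \<nu> ` qvars Q = {}"
    if "i < length (atoms Q)" for i
    using m that len nth_mem[of i pws] by (fastforce simp: split_beta)
  ultimately show ?thesis
    unfolding qinj_match_def Let_def using inj m
    by (intro exI[of _ \<nu>] exI[of _ "\<lambda>i. fst (pws ! i)"] exI[of _ "\<lambda>i. snd (pws ! i)"]) auto
qed

section \<open>Atoms whose language contains the empty word, and the recursive semantics\<close>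

lemma list_all2_append_Cons1:
  "list_all2 P (As @ a # Bs) cs \<longleftrightarrow>
    (\<exists>us u vs. cs = us @ u # vs \<and> list_all2 P As us \<and> P a u \<and> list_all2 P Bs vs)"
  (is "?L \<longleftrightarrow> ?R")
proof
  show "?L \<Longrightarrow> ?R"
    by (auto simp: list_all2_append1 list_all2_Cons1)
  show "?R \<Longrightarrow> ?L"
    by (auto intro!: list_all2_appendI)
qed

text \<open>Used to undo the rule \<open>remove_eps\<close>: the chosen words, and with them the
  identified variables, stay the same when a language grows.\<close>

lemma word_match_mono:
  assumes "word_match G (Q\<lparr>atoms := As @ (x, L, y) # Bs\<rparr>) vs \<nu> pws" "L \<subseteq> L'"
  shows "word_match G (Q\<lparr>atoms := As @ (x, L', y) # Bs\<rparr>) vs \<nu> pws"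
proof -
  obtain us u ws where pws: "pws = us @ u # ws" "list_all2 (realizes G \<nu>) As us"
    "realizes G \<nu> (x, L, y) u" "list_all2 (realizes G \<nu>) Bs ws"
    using assms(1) by (auto simp: word_match_def list_all2_append_Cons1)
  then have "realizes G \<nu> (x, L', y) u"
    using assms(2) by (auto simp: realizes_def split: if_splits)
  then show ?thesis
    using assms(1) pws
    by (auto simp: word_match_def eps_pairs_append eps_pairs_Cons list_all2_lengthD
        intro!: list_all2_appendI)
qed

text \<open>The empty word forces \<open>\<nu> x = \<nu> y\<close>, so \<nu> does not notice the
  substitution \<open>s\<close> and remains a match after it. Only the kernel condition has to be
  carried over to the substituted pairs.\<close>

lemma word_match_drop_eps:
  fixes x y
  defines "s \<equiv> id(x := y)"
  assumes "word_match G (Q\<lparr>atoms := As @ (x, L, y) # Bs\<rparr>) vs \<nu> (us @ (p, []) # ws)"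
    and "length As = length us"
  shows "word_match G (map_query s id (Q\<lparr>atoms := As @ Bs\<rparr>)) vs \<nu> (us @ ws)"
proof -
  let ?R = "eps_pairs (As @ Bs) (map snd us @ map snd ws)"
  note m = assms(2)[unfolded word_match_def, simplified]
  have l: "list_all2 (realizes G \<nu>) As us" "realizes G \<nu> (x, L, y) (p, [])"
    "list_all2 (realizes G \<nu>) Bs ws"
    using m assms(3) by (auto simp: list_all2_append)
  then have "\<nu> x = \<nu> y"
    by (simp add: realizes_def is_path_Nil)
  then have \<nu>: "\<nu> \<circ> s = \<nu>" by (auto simp: s_def)
  then have \<nu>_app: "\<nu> (s v) = \<nu> v" for v by (metis comp_apply)
  have R: "eps_pairs (As @ (x, L, y) # Bs) (map snd us @ [] # map snd ws) = insert (x, y) ?R"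
    using assms(3) by (simp add: eps_pairs_append eps_pairs_Cons)
  have "(s u, s v) \<in> equiv_closure (map_prod s s ` ?R)"
    if "u \<in> qvars Q" "v \<in> qvars Q" "\<nu> u = \<nu> v" for u v
  proof (rule equiv_closure_map[where f = s and R = "insert (x, y) ?R"])
    show "(u, v) \<in> equiv_closure (insert (x, y) ?R)"
      using m that by (simp add: R)
    \<comment> \<open>The pair \<open>(x, y)\<close> becomes the reflexive pair
      \<open>(y, y)\<close>; every other generator goes to its own image.\<close>
    show "(s a, s b) \<in> equiv_closure (map_prod s s ` ?R)" if "(a, b) \<in> insert (x, y) ?R" for a b
    proof (cases "(a, b) = (x, y)")
      case True
      then show ?thesis by (simp add: s_def)
    next
      case False
      then have "(s a, s b) \<in> map_prod s s ` ?R" using that by (metis insertE map_prod_imageI)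
      then show ?thesis by (intro r_into_rtrancl UnI1)
    qed
  qed
  moreover have "\<nu> ` s ` qvars Q = \<nu> ` qvars Q"
    by (simp only: image_comp \<nu>)
  ultimately show ?thesis
    using m l
    by (simp add: word_match_def map_query_def list_all2_realizes_map \<nu> \<nu>_app
        list_all2_appendI eps_pairs_map sorted_wrt_append flip: map_append)
qed

text \<open>Precomposing with \<open>s\<close> gives \<open>x\<close> the image of \<open>y\<close>,
  and the one-node path at that image realizes the new atom. The kernel condition lifts because the
  added pair \<open>(x, y)\<close> links every variable \<open>a\<close> to \<open>s a\<close>, so a
  substituted pair can be replaced by a chain through the original one.\<close>

lemma word_match_insert_eps:
  fixes x y
  defines "s \<equiv> id(x := y)"
  assumes "word_match G (map_query s id (Q\<lparr>atoms := As @ Bs\<rparr>)) vs \<nu> pws"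
    and "[] \<in> L" "x \<in> qvars Q" "y \<in> qvars Q"
  shows "\<exists>pws'. word_match G (Q\<lparr>atoms := As @ (x, L, y) # Bs\<rparr>) vs (\<nu> \<circ> s) pws'"
proof -
  note m = assms(2)[unfolded word_match_def map_query_def, simplified, folded map_append,
      unfolded list_all2_realizes_map eps_pairs_map]
  obtain us ws where pws: "pws = us @ ws"
    and l: "list_all2 (realizes G (\<nu> \<circ> s)) As us" "list_all2 (realizes G (\<nu> \<circ> s)) Bs ws"
    using m by (auto simp: list_all2_append1)
  let ?R = "eps_pairs (As @ Bs) (map snd us @ map snd ws)"
  let ?R' = "insert (x, y) ?R"
  have s: "s x = y" "s y = y" by (auto simp: s_def)
  have y: "\<nu> y \<in> \<nu> ` s ` qvars Q" using s(2) assms(5) by force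
  have real: "realizes G (\<nu> \<circ> s) (x, L, y) ([\<nu> y], [])"
    using m y assms(3) by (auto simp: realizes_def is_path_Nil s simple_cycle_def)
  have R: "eps_pairs (As @ (x, L, y) # Bs) (map snd us @ [] # map snd ws) = ?R'"
    using list_all2_lengthD[OF l(1)] by (simp add: eps_pairs_append eps_pairs_Cons)
  have s_equiv: "(a, s a) \<in> equiv_closure ?R'" for a
    by (auto simp: s_def)
  have "(u, v) \<in> equiv_closure ?R'"
    if "u \<in> qvars Q" "v \<in> qvars Q" "\<nu> (s u) = \<nu> (s v)" for u v
  proof -
    have "(s u, s v) \<in> equiv_closure (map_prod s s ` ?R)"
      using m that pws by auto
    then have "(s u, s v) \<in> equiv_closure ?R'"
    proof (rule equiv_closure_map[where f = "\<lambda>v. v", rotated])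
      fix c d assume "(c, d) \<in> map_prod s s ` ?R"
      then obtain a b where "(a, b) \<in> ?R" and cd: "c = s a" "d = s b" by auto
      then have "(a, b) \<in> equiv_closure ?R'" by blast
      then have "(s a, b) \<in> equiv_closure ?R'"
        by (rule rtrancl_trans[OF s_equiv[THEN equiv_closure_sym]])
      then show "(c, d) \<in> equiv_closure ?R'"
        unfolding cd by (rule rtrancl_trans[OF _ s_equiv])
    qed
    then have "(u, s v) \<in> equiv_closure ?R'"
      by (rule rtrancl_trans[OF s_equiv])
    then show ?thesis
      by (rule rtrancl_trans[OF _ s_equiv[THEN equiv_closure_sym]])
  qed
  \<comment> \<open>A one-node path has no internal node, and its only node is the image of a
    variable, which the internal nodes of the other paths avoid.\<close>
  moreover have "independent pw ([\<nu> y], [])" "independent ([\<nu> y], []) pw"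
    if "pw \<in> set pws" for pw
  proof -
    have "internal_nodes (fst pw) \<inter> \<nu> ` s ` qvars Q = {}"
      using m that by (simp add: case_prod_unfold)
    then have "\<nu> y \<notin> internal_nodes (fst pw)" using y by blast
    then show "independent pw ([\<nu> y], [])" "independent ([\<nu> y], []) pw"
      by (simp_all add: independent_def case_prod_unfold)
  qed
  ultimately have "word_match G (Q\<lparr>atoms := As @ (x, L, y) # Bs\<rparr>) vs (\<nu> \<circ> s)
      (us @ ([\<nu> y], []) # ws)"
    using m l real pws
    by (auto simp: word_match_def R sorted_wrt_append image_comp intro!: list_all2_appendI)
  then show ?thesis ..
qed

text \<open>Induction on the derivation, undoing each rule: \<open>remove_eps\<close> by enlarging
  the language, \<open>identify\<close> by inserting a one-node path and composing with the
  substitution.\<close>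

lemma word_match_if_qinj_sem:
  "qinj_sem G Q vs \<Longrightarrow> wf_query Q \<Longrightarrow> \<exists>\<nu> pws. word_match G Q vs \<nu> pws"
proof (induction rule: qinj_sem.induct)
  case (no_eps Q vs)
  then show ?case by (blast intro: word_match_if_qinj_match)
next
  case (remove_eps Q As x L y Bs vs)
  then have Q: "Q\<lparr>atoms := As @ (x, L, y) # Bs\<rparr> = Q" by simp
  have "wf_query (Q\<lparr>atoms := As @ (x, L - {[]}, y) # Bs\<rparr>)"
    using remove_eps.prems remove_eps.hyps(1) by (auto simp: wf_query_def)
  then obtain \<nu> pws where "word_match G (Q\<lparr>atoms := As @ (x, L - {[]}, y) # Bs\<rparr>) vs \<nu> pws"
    using remove_eps.IH by blast
  then have "word_match G (Q\<lparr>atoms := As @ (x, L, y) # Bs\<rparr>) vs \<nu> pws"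
    by (rule word_match_mono) blast
  then show ?case unfolding Q by blast
next
  case (identify Q As x L y Bs vs)
  then have Q: "Q\<lparr>atoms := As @ (x, L, y) # Bs\<rparr> = Q" by simp
  have "wf_query (map_query (id(x := y)) id (Q\<lparr>atoms := As @ Bs\<rparr>))"
    using identify.prems identify.hyps(1) by (intro wf_query_map_query) (auto simp: wf_query_def)
  then obtain \<nu> pws where
    "word_match G (map_query (id(x := y)) id (Q\<lparr>atoms := As @ Bs\<rparr>)) vs \<nu> pws"
    using identify.IH by blast
  moreover have "x \<in> qvars Q" "y \<in> qvars Q"
    using identify.prems identify.hyps(1) by (auto simp: wf_query_def)
  ultimately have "\<exists>pws. word_match G (Q\<lparr>atoms := As @ (x, L, y) # Bs\<rparr>) vs (\<nu> \<circ> id(x := y)) pws"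
    using identify.hyps(2) by (intro word_match_insert_eps)
  then show ?case unfolding Q by blast
qed

text \<open>Induction on the number of atoms whose language contains the empty word. The word that
  the match chooses for such an atom decides the rule: \<open>identify\<close> if it is empty,
  \<open>remove_eps\<close> otherwise. Both lower the count.\<close>

lemma qinj_sem_if_word_match:
  "wf_query Q \<Longrightarrow> word_match G Q vs \<nu> pws \<Longrightarrow> qinj_sem G Q vs"
proof (induction "length (filter (\<lambda>(x, L, y). [] \<in> L) (atoms Q))" arbitrary: Q pws
    rule: less_induct)
  case less
  show ?case
  proof (cases "\<forall>(x, L, y) \<in> set (atoms Q). [] \<notin> L")
    case True
    then show ?thesis
      using less.prems by (intro no_eps qinj_match_if_word_match)
  next
    case False
    then obtain As x L y Bs where a: "atoms Q = As @ (x, L, y) # Bs" and L: "[] \<in> L"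
      by (fastforce dest: split_list)
    then have Q: "Q = Q\<lparr>atoms := As @ (x, L, y) # Bs\<rparr>" by simp
    obtain us p w ws where pws: "pws = us @ (p, w) # ws" "list_all2 (realizes G \<nu>) As us"
      "realizes G \<nu> (x, L, y) (p, w)" "list_all2 (realizes G \<nu>) Bs ws"
      using less.prems(2) a by (auto simp: word_match_def list_all2_append_Cons1)
    show ?thesis
    proof (cases "w = []")
      case True
      then have "word_match G (map_query (id(x := y)) id (Q\<lparr>atoms := As @ Bs\<rparr>)) vs \<nu> (us @ ws)"
        using less.prems(2) pws word_match_drop_eps Q list_all2_lengthD by metis
      moreover have "wf_query (map_query (id(x := y)) id (Q\<lparr>atoms := As @ Bs\<rparr>))"
        using less.prems(1) a by (intro wf_query_map_query) (auto simp: wf_query_def)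
      ultimately have "qinj_sem G (map_query (id(x := y)) id (Q\<lparr>atoms := As @ Bs\<rparr>)) vs"
        using a L by (intro less.hyps) (auto simp: map_query_def filter_map comp_def case_prod_unfold)
      with a L show ?thesis by (rule qinj_sem.identify)
    next
      case False
      have "realizes G \<nu> (x, L - {[]}, y) (p, w)"
        using pws(3) False by (auto simp: realizes_def)
      then have "word_match G (Q\<lparr>atoms := As @ (x, L - {[]}, y) # Bs\<rparr>) vs \<nu> pws"
        using less.prems(2) a pws
        by (auto simp: word_match_def eps_pairs_append eps_pairs_Cons list_all2_lengthD
            intro!: list_all2_appendI)
      moreover have "wf_query (Q\<lparr>atoms := As @ (x, L - {[]}, y) # Bs\<rparr>)"
        using less.prems(1) a by (auto simp: wf_query_def)
      ultimately have "qinj_sem G (Q\<lparr>atoms := As @ (x, L - {[]}, y) # Bs\<rparr>) vs"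
        using a L by (intro less.hyps) auto
      with a L show ?thesis by (rule qinj_sem.remove_eps)
    qed
  qed
qed

theorem qinj_sem_iff_word_match:
  "wf_query Q \<Longrightarrow> qinj_sem G Q vs \<longleftrightarrow> (\<exists>\<nu> pws. word_match G Q vs \<nu> pws)"
  using word_match_if_qinj_sem qinj_sem_if_word_match by blast


section \<open>Matches and expansions\<close>

text \<open>Equality atoms relate original variables only, so every fresh variable is alone in its
  class.\<close>

lemma equiv_closure_Orig:
  assumes "(u, v) \<in> equiv_closure (map_prod Orig Orig ` R)"
  shows "u = v \<or> (\<exists>x y. u = Orig x \<and> v = Orig y \<and> (x, y) \<in> equiv_closure R)"
  using assms
proof (induction rule: rtrancl_induct)
  case (step v w)
  then obtain y z where "v = Orig y" "w = Orig z" "(y, z) \<in> R \<union> R\<inverse>" by auto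
  then show ?case using step.IH by (metis evar.inject(1) r_into_rtrancl rtrancl.rtrancl_into_rtrancl)
qed simp

lemma eq_atoms_eq_eps_pairs:
  "length ws = length (atoms Q) \<Longrightarrow> eq_atoms Q ws = map_prod Orig Orig ` eps_pairs (atoms Q) ws"
  unfolding eq_atoms_def eps_pairs_def
  by (auto simp: in_set_zip image_iff)

lemma eps_pairs_map_query_id: "eps_pairs (atoms (map_query id g Q)) ws = eps_pairs (atoms Q) ws"
  unfolding map_query_def by (simp add: eps_pairs_map map_prod.id)

lemma mem_word_expansion:
  "(u, a, v) \<in> set (word_expansion i x y w) \<longleftrightarrow> (\<exists>j < length w.
    u = exp_var i x y (length w) j \<and> a = w ! j \<and> v = exp_var i x y (length w) (Suc j))"
  by (auto simp: word_expansion_def)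

lemma mem_atoms_pre_expansion:
  "(u, a, v) \<in> set (atoms (pre_expansion Q ws)) \<longleftrightarrow>
    (\<exists>i x r y j. i < length (atoms Q) \<and> atoms Q ! i = (x, r, y) \<and> j < length (ws ! i) \<and>
      u = exp_var i x y (length (ws ! i)) j \<and> a = ws ! i ! j \<and>
      v = exp_var i x y (length (ws ! i)) (Suc j))"
proof -
  have case_iff: "(case t of (x, r, y) \<Rightarrow> P x r y) \<longleftrightarrow> (\<exists>x r y. t = (x, r, y) \<and> P x r y)"
    for t :: "'a \<times> 'b rexp \<times> 'a" and P
    by (cases t) simp
  have "(u, a, v) \<in> set (atoms (pre_expansion Q ws)) \<longleftrightarrow>
    (\<exists>i < length (atoms Q). case atoms Q ! i of (x, r, y) \<Rightarrow>
      (u, a, v) \<in> set (word_expansion i x y (ws ! i)))"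
    by (auto simp: pre_expansion_def case_prod_unfold)
  also have "\<dots> \<longleftrightarrow> (\<exists>i x r y. i < length (atoms Q) \<and> atoms Q ! i = (x, r, y) \<and>
      (u, a, v) \<in> set (word_expansion i x y (ws ! i)))"
    unfolding case_iff by blast
  finally show ?thesis unfolding mem_word_expansion by blast
qed

text \<open>The words of the match form the expansion profile. Sending original variables along
  \<nu> and fresh variables to internal nodes of the paths gives a homomorphism on
  \<open>pre_expansion\<close>, which passes to the collapsed query once its kernel is
  known.\<close>

lemma inj_hom_if_word_match:
  assumes "wf_query Q" "word_match G (map_query id lang Q) vs \<nu> pws"
  shows "\<exists>E \<in> Exp Q. \<exists>g. is_hom g E G vs \<and> inj_on g (qvars E)"
proof -
  note m = assms(2)[unfolded word_match_def eps_pairs_map_query_id]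
  let ?m = "length (atoms Q)" and ?p = "\<lambda>i. fst (pws ! i)"
  define ws where "ws = map snd pws"
  have len: "length pws = ?m" "length ws = ?m"
    using m by (auto simp: ws_def map_query_def dest: list_all2_lengthD)
  have \<nu>: "\<nu> ` qvars Q \<subseteq> nodes G" "map \<nu> (free Q) = vs"
    using m by (auto simp: map_query_def)
  have r: "realizes G \<nu> (x, lang r, y) (?p i, ws ! i)"
    if "i < ?m" "atoms Q ! i = (x, r, y)" for i x r y
    using m that len by (auto simp: map_query_def list_all2_conv_all_nth ws_def)
  have path: "is_path G (\<nu> x) (?p i) (ws ! i) (\<nu> y)"
    if "i < ?m" "atoms Q ! i = (x, r, y)" for i x r y
    using r[OF that] by (simp add: realizes_def)
  have length_p: "length (?p i) = Suc (length (ws ! i))" if i: "i < ?m" for i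
    using path[OF i] by (cases "atoms Q ! i") (auto simp: is_path_def)
  have internal: "?p i ! j \<in> internal_nodes (?p i)" if "i < ?m" "0 < j" "j < length (ws ! i)" for i j
    using that length_p by (auto simp: internal_nodes_def)
  have internal_\<nu>: "internal_nodes (?p i) \<inter> \<nu> ` qvars Q = {}" if i: "i < ?m" for i
  proof -
    have "pws ! i \<in> set pws" using i len by simp
    then show ?thesis using m by (auto simp: map_query_def case_prod_unfold)
  qed
  have internal_neq_\<nu>: "?p i ! j \<noteq> \<nu> x"
    if "i < ?m" "0 < j" "j < length (ws ! i)" "x \<in> qvars Q" for i j x
    using internal[OF that(1-3)] internal_\<nu>[OF that(1)] that(4) by (metis IntI empty_iff imageI)
  \<comment> \<open>Dropping the last node treats simple paths and simple cycles alike, and still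
    keeps every internal node.\<close>
  have distinct_p: "distinct (butlast (?p i))" if i: "i < ?m" for i
    using r[OF i] by (cases "atoms Q ! i")
      (auto simp: realizes_def simple_cycle_def simple_path_def distinct_butlast split: if_splits)
  \<comment> \<open>\<open>Fresh i j\<close> goes to the \<open>j\<close>-th node of the
    \<open>i\<close>-th path.\<close>
  define h where "h = case_evar \<nu> (\<lambda>i. (!) (?p i))"
  have h_exp_var: "h (exp_var i x y (length (ws ! i)) j) = ?p i ! j"
    if "i < ?m" "atoms Q ! i = (x, r, y)" "j \<le> length (ws ! i)" for i x r y j
    using path[OF that(1,2)] by (auto simp: h_def exp_var_def is_path_def)
  have "is_hom h (pre_expansion Q ws) G vs"
    unfolding is_hom_def
  proof (intro conjI)
    have "?p i ! j \<in> nodes G" if i: "i < ?m" "j < length (ws ! i)" for i j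
    proof -
      obtain x r y where "atoms Q ! i = (x, r, y)" by (metis prod_cases3)
      then have "set (?p i) \<subseteq> nodes G" using path i(1) by (auto simp: is_path_def)
      moreover have "?p i ! j \<in> set (?p i)" using i length_p by simp
      ultimately show ?thesis ..
    qed
    then show "h ` qvars (pre_expansion Q ws) \<subseteq> nodes G"
      using \<nu> by (auto simp: pre_expansion_def h_def)
    show "map h (free (pre_expansion Q ws)) = vs"
      using \<nu> by (simp add: pre_expansion_def h_def comp_def)
    have "(h u, a, h v) \<in> edges G" if "(u, a, v) \<in> set (atoms (pre_expansion Q ws))" for u a v
    proof -
      obtain i x r y j where ij: "i < ?m" "atoms Q ! i = (x, r, y)" "j < length (ws ! i)"
        "u = exp_var i x y (length (ws ! i)) j" "a = ws ! i ! j"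
        "v = exp_var i x y (length (ws ! i)) (Suc j)"
        using \<open>(u, a, v) \<in> _\<close> unfolding mem_atoms_pre_expansion by blast
      then show ?thesis using path[OF ij(1,2)] h_exp_var[OF ij(1,2)] by (simp add: is_path_def)
    qed
    then show "\<forall>(u, a, v) \<in> set (atoms (pre_expansion Q ws)). (h u, a, h v) \<in> edges G"
      by blast
  qed
  moreover have "h u = h v" if "(u, v) \<in> eq_atoms Q ws" for u v
  proof -
    obtain x y i r where "u = Orig x" "v = Orig y" "i < ?m" "atoms Q ! i = (x, r, y)" "ws ! i = []"
      using \<open>(u, v) \<in> _\<close> unfolding eq_atoms_def by blast
    then show ?thesis using path[of i x r y] by (simp add: h_def is_path_Nil)
  qed
  \<comment> \<open>Two original variables fall under the kernel condition of the match. An original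
    and a fresh one cannot meet, since internal nodes avoid the images of variables. Two fresh ones
    that meet are equal, by independence of different paths and simplicity of each.\<close>
  moreover have "(u, v) \<in> equiv_closure (eq_atoms Q ws)"
    if uv: "u \<in> qvars (pre_expansion Q ws)" "v \<in> qvars (pre_expansion Q ws)" "h u = h v" for u v
  proof (cases u)
    case u: (Orig x)
    then have x: "x \<in> qvars Q" using uv(1) by (auto simp: pre_expansion_def)
    show ?thesis
    proof (cases v)
      case v: (Orig y)
      then have "y \<in> qvars Q" using uv(2) by (auto simp: pre_expansion_def)
      then have "(x, y) \<in> equiv_closure (eps_pairs (atoms Q) ws)"
        using m uv(3) x by (auto simp: u v h_def ws_def map_query_def)
      then show ?thesis
        unfolding u v eq_atoms_eq_eps_pairs[OF len(2)]
        by (rule equiv_closure_map[rotated]) force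
    next
      case v: (Fresh i j)
      then have "i < ?m" "0 < j" "j < length (ws ! i)" using uv(2) by (auto simp: pre_expansion_def)
      then show ?thesis
        using internal_neq_\<nu>[of i j x] uv(3) x by (simp add: u v h_def)
    qed
  next
    case u: (Fresh i j)
    then have i: "i < ?m" "0 < j" "j < length (ws ! i)" using uv(1) by (auto simp: pre_expansion_def)
    show ?thesis
    proof (cases v)
      case v: (Orig y)
      then have "y \<in> qvars Q" using uv(2) by (auto simp: pre_expansion_def)
      then show ?thesis
        using internal_neq_\<nu>[OF i, of y] uv(3) by (simp add: u v h_def)
    next
      case v: (Fresh i' j')
      then have i': "i' < ?m" "0 < j'" "j' < length (ws ! i')"
        using uv(2) by (auto simp: pre_expansion_def)
      have eq: "?p i ! j = ?p i' ! j'" using uv(3) by (simp add: u v h_def)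
      have "i = i'"
      proof (rule ccontr)
        assume "i \<noteq> i'"
        then have "internal_nodes (?p i) \<inter> set (?p i') = {}"
          using m i(1) i'(1) len by (intro sorted_wrt_independentD) auto
        moreover have "?p i' ! j' \<in> set (?p i')" using i' length_p by simp
        ultimately show False using internal[OF i] eq by auto
      qed
      moreover from this have "j = j'"
        using eq i i' distinct_p[OF i(1)] length_p[OF i(1)]
        by (metis diff_Suc_1 length_butlast nth_butlast nth_eq_iff_index_eq)
      ultimately show ?thesis by (simp add: u v)
    qed
  qed
  ultimately have "\<exists>g. is_hom g (collapse (eq_atoms Q ws) (pre_expansion Q ws)) G vs \<and>
      inj_on g (qvars (collapse (eq_atoms Q ws) (pre_expansion Q ws)))"
    unfolding inj_hom_collapse_iff by blast
  moreover have "expansion_profile Q ws"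
    unfolding expansion_profile_def
  proof (rule list_all2_all_nthI)
    fix i assume i: "i < ?m"
    obtain x s y where a: "atoms Q ! i = (x, s, y)" by (metis prod_cases3)
    then show "(\<lambda>(x, r, y) w. w \<in> lang r) (atoms Q ! i) (ws ! i)"
      using r[OF i a] by (simp add: realizes_def)
  qed (simp add: len)
  then have "collapse (eq_atoms Q ws) (pre_expansion Q ws) \<in> Exp Q"
    unfolding Exp_def by blast
  ultimately show ?thesis ..
qed

text \<open>The paths are read off as the images of the expanded atoms. Simplicity and disjointness
  all come from one fact: \<open>h\<close> gives a fresh variable an image that it shares with no
  other variable.\<close>

lemma word_match_if_inj_hom:
  assumes "wf_query Q" "E \<in> Exp Q" "is_hom g E G vs" "inj_on g (qvars E)"
  shows "\<exists>\<nu> pws. word_match G (map_query id lang Q) vs \<nu> pws"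
proof -
  obtain ws where E: "E = collapse (eq_atoms Q ws) (pre_expansion Q ws)"
    and profile: "list_all2 (\<lambda>(x, r, y) w. w \<in> lang r) (atoms Q) ws"
    using assms(2) by (auto simp: Exp_def expansion_profile_def)
  let ?m = "length (atoms Q)" and ?P = "pre_expansion Q ws"
  have len: "length ws = ?m" using profile by (simp add: list_all2_lengthD)
  have "\<exists>g. is_hom g (collapse (eq_atoms Q ws) ?P) G vs \<and>
      inj_on g (qvars (collapse (eq_atoms Q ws) ?P))"
    using assms(3,4) unfolding E by blast
  then obtain h where hom: "is_hom h ?P G vs"
    and h_eq: "\<And>u v. (u, v) \<in> eq_atoms Q ws \<Longrightarrow> h u = h v"
    and "\<And>u v. u \<in> qvars ?P \<Longrightarrow> v \<in> qvars ?P \<Longrightarrow> h u = h v \<Longrightarrow>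
      (u, v) \<in> equiv_closure (eq_atoms Q ws)"
    unfolding inj_hom_collapse_iff by blast
  note kernel = this(3)[unfolded eq_atoms_eq_eps_pairs[OF len]]
  \<comment> \<open>The class of a fresh variable is a singleton, so the kernel condition leaves
    only the variable itself.\<close>
  have fresh: "v = Fresh i j"
    if "i < ?m" "0 < j" "j < length (ws ! i)" "v \<in> qvars ?P" "h (Fresh i j) = h v" for i j v
    using equiv_closure_Orig[OF kernel[of "Fresh i j" v]] that by (auto simp: pre_expansion_def)
  let ?k = "\<lambda>i. length (ws ! i)"
  let ?e = "\<lambda>i. exp_var i (fst (atoms Q ! i)) (snd (snd (atoms Q ! i))) (?k i)"
  define p where "p i = map (h \<circ> ?e i) [0..<Suc (?k i)]" for i
  let ?pws = "map (\<lambda>i. (p i, ws ! i)) [0..<?m]"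
  have vars: "fst (atoms Q ! i) \<in> qvars Q" "snd (snd (atoms Q ! i)) \<in> qvars Q" if "i < ?m" for i
    using assms(1) nth_mem[OF that] by (auto simp: wf_query_def case_prod_unfold)
  have e_mem: "?e i j \<in> qvars ?P" if "i < ?m" "j \<le> ?k i" for i j
    using vars[OF that(1)] that by (auto simp: pre_expansion_def exp_var_def)
  have e_fresh: "?e i j = Fresh i j" if "0 < j" "j < ?k i" for i j
    using that by (simp add: exp_var_def)
  have internal: "internal_nodes (p i) = {h (Fresh i j) | j. 0 < j \<and> j < ?k i}" for i
    unfolding internal_nodes_def p_def by (force simp: e_fresh simp del: upt_Suc)
  \<comment> \<open>At \<open>j = 0\<close> the function \<open>exp_var\<close> returns the source
    even when the word is empty; in that case the equality atom makes \<open>h\<close> agree on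
    source and target.\<close>
  have p_last: "h (?e i (?k i)) = h (Orig (snd (snd (atoms Q ! i))))" if i: "i < ?m" for i
  proof (cases "ws ! i = []")
    case True
    then have "(Orig (fst (atoms Q ! i)), Orig (snd (snd (atoms Q ! i)))) \<in> eq_atoms Q ws"
      using i by (auto simp: eq_atoms_def) (metis prod.collapse)
    then show ?thesis using True h_eq by (simp add: exp_var_def)
  qed (simp add: exp_var_def)
  have path: "is_path G (h (Orig (fst (atoms Q ! i)))) (p i) (ws ! i)
      (h (Orig (snd (snd (atoms Q ! i)))))" if i: "i < ?m" for i
    unfolding is_path_def
  proof (intro conjI)
    show "length (p i) = Suc (?k i)" by (simp add: p_def)
    show "p i ! 0 = h (Orig (fst (atoms Q ! i)))"
      by (simp add: p_def exp_var_def del: upt_Suc)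
    show "p i ! ?k i = h (Orig (snd (snd (atoms Q ! i))))"
      using p_last[OF i] by (simp add: p_def del: upt_Suc)
    show "set (p i) \<subseteq> nodes G"
      using e_mem[OF i] hom by (auto simp: p_def is_hom_def simp del: upt_Suc)
    have "(?e i j, ws ! i ! j, ?e i (Suc j)) \<in> set (atoms ?P)" if "j < ?k i" for j
      unfolding mem_atoms_pre_expansion using i that by (metis prod.collapse)
    then show "\<forall>j < ?k i. (p i ! j, ws ! i ! j, p i ! Suc j) \<in> edges G"
      using hom by (fastforce simp: p_def is_hom_def simp del: upt_Suc)
  qed
  have butlast_p: "butlast (p i) = map (h \<circ> ?e i) [0..<?k i]" for i
    by (simp add: p_def map_butlast)
  \<comment> \<open>The last premise excludes only the pair of both endpoints, so at least one of
    the two positions carries a fresh variable. The premises are in fact contradictory, and the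
    conclusion is a form of that contradiction.\<close>
  have e_inj: "j = j'" if "i < ?m" "j < j'" "j' \<le> ?k i" "h (?e i j) = h (?e i j')"
     "0 < j \<or> j' < ?k i" for i j j'
  proof (cases "0 < j")
    case True
    then have "?e i j' = Fresh i j"
      using that e_mem by (intro fresh) (auto simp: e_fresh)
    then show ?thesis by (auto simp: exp_var_def split: if_splits)
  next
    case False
    then have "?e i j = Fresh i j'"
      using that e_mem by (intro fresh) (auto simp: e_fresh)
    then show ?thesis by (auto simp: exp_var_def split: if_splits)
  qed
  have distinct_butlast_p: "distinct (butlast (p i))" if "i < ?m" for i
    unfolding butlast_p distinct_map
  proof (intro conjI linorder_inj_onI)
    fix j j' assume "j < j'" "j \<in> set [0..<?k i]" "j' \<in> set [0..<?k i]"
    then show "(h \<circ> ?e i) j \<noteq> (h \<circ> ?e i) j'"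
      using e_inj[OF that, of j j'] by auto
  qed auto
  have realizes_p: "realizes G (h \<circ> Orig) (x, lang r, y) (p i, ws ! i)"
    if i: "i < ?m" and a: "atoms Q ! i = (x, r, y)" for i x r y
  proof -
    have "simple_path (p i)" if "h (Orig x) \<noteq> h (Orig y)"
      unfolding simple_path_def p_def distinct_map
    proof (intro conjI linorder_inj_onI)
      fix j j' assume j: "j < j'" "j \<in> set [0..<Suc (?k i)]" "j' \<in> set [0..<Suc (?k i)]"
      show "(h \<circ> ?e i) j \<noteq> (h \<circ> ?e i) j'"
      proof (cases "0 < j \<or> j' < ?k i")
        case True
        then show ?thesis using e_inj[OF i, of j j'] j by auto
      next
        \<comment> \<open>Only the two endpoints remain, whose images differ by assumption.\<close>
        case False
        then have "j = 0" "j' = ?k i" using j by auto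
        then show ?thesis using that p_last[OF i] a by (simp add: exp_var_def)
      qed
    qed auto
    moreover have "simple_cycle (p i)" if "h (Orig x) = h (Orig y)"
      using that path[OF i] distinct_butlast_p[OF i] a is_path_hd_last
      by (fastforce simp: simple_cycle_def)
    moreover have "ws ! i \<in> lang r"
      using profile i a by (auto dest: list_all2_nthD)
    ultimately show ?thesis
      using path[OF i] a by (simp add: realizes_def)
  qed
  have "list_all2 (realizes G (h \<circ> Orig)) (atoms (map_query id lang Q)) ?pws"
    by (rule list_all2_all_nthI) (auto simp: map_query_def split: prod.split intro: realizes_p)
  moreover have "internal_nodes (p i) \<inter> set (p i') = {}" if "i < ?m" "i' < ?m" "i \<noteq> i'" for i i'
  proof -
    have "h (?e i' j') \<noteq> h (Fresh i j)" if "0 < j" "j < ?k i" "j' \<le> ?k i'" for j j'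
    proof
      assume "h (?e i' j') = h (Fresh i j)"
      from this[symmetric] have "?e i' j' = Fresh i j"
        using that \<open>i < ?m\<close> \<open>i' < ?m\<close> e_mem by (intro fresh)
      then show False using \<open>i \<noteq> i'\<close> by (simp add: exp_var_def split: if_splits)
    qed
    then show ?thesis unfolding internal by (auto simp: p_def simp del: upt_Suc)
  qed
  then have "sorted_wrt independent ?pws"
    by (auto simp: sorted_wrt_iff_nth_less independent_def)
  moreover have "internal_nodes (p i) \<inter> (h \<circ> Orig) ` qvars Q = {}" if "i < ?m" for i
  proof -
    have "h (Orig x) \<noteq> h (Fresh i j)" if "x \<in> qvars Q" "0 < j" "j < ?k i" for x j
      using fresh[OF \<open>i < ?m\<close>, of j "Orig x"] that by (auto simp: pre_expansion_def)
    then show ?thesis unfolding internal by auto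
  qed
  moreover have "(x, y) \<in> equiv_closure (eps_pairs (atoms Q) ws)"
    if "x \<in> qvars Q" "y \<in> qvars Q" "h (Orig x) = h (Orig y)" for x y
    using equiv_closure_Orig[OF kernel[of "Orig x" "Orig y"]] that by (auto simp: pre_expansion_def)
  moreover have "map snd ?pws = ws"
    using len by (auto intro: nth_equalityI)
  ultimately have "word_match G (map_query id lang Q) vs (h \<circ> Orig) ?pws"
    using hom unfolding word_match_def eps_pairs_map_query_id
    by (auto simp: map_query_def is_hom_def pre_expansion_def)
  then show ?thesis by blast
qed

theorem mem_qinj_eval_iff:
  assumes "wf_query Q"
  shows "vs \<in> qinj_eval Q G \<longleftrightarrow> (\<exists>E \<in> Exp Q. \<exists>g. is_hom g E G vs \<and> inj_on g (qvars E))"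
  using assms inj_hom_if_word_match word_match_if_inj_hom
  unfolding qinj_eval_def mem_Collect_eq
    qinj_sem_iff_word_match[OF wf_query_map_query[OF assms]] by blast

section \<open>From evaluation to containment\<close>

lemma wf_query_if_crpq: "crpq Q \<Longrightarrow> wf_query Q"
  by (auto simp: crpq_def wf_query_def case_prod_unfold)

lemma is_hom_graph_of_comp:
  assumes "is_hom g P (graph_of P') (free P')" "is_hom h P' G vs"
  shows "is_hom (h \<circ> g) P G vs"
proof -
  have "map (h \<circ> g) (free P) = vs"
    using assms by (simp add: is_hom_def flip: map_map)
  moreover have "(h (g x), a, h (g y)) \<in> edges G" if "(x, a, y) \<in> set (atoms P)" for x a y
    using assms that by (auto simp: is_hom_def graph_of_def dest!: bspec)
  moreover have "(h \<circ> g) ` qvars P \<subseteq> nodes G"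
    using assms unfolding image_comp[symmetric]
    by (simp add: is_hom_def graph_of_def) (meson image_mono order_trans)
  ultimately show ?thesis
    by (auto simp: is_hom_def)
qed

text \<open>Leads back from a renamed copy to the query itself. Well-formedness ensures that the
  atoms and the free tuple only mention variables on which \<open>inv_into\<close> undoes
  \<open>f\<close>.\<close>

lemma is_hom_inv_into:
  assumes "wf_query P" "inj_on f (qvars P)"
  shows "is_hom (inv_into (qvars P) f) (map_query f id P) (graph_of P) (free P)"
proof -
  have "map (inv_into (qvars P) f \<circ> f) (free P) = free P"
    using assms by (intro map_idI) (auto simp: wf_query_def)
  then show ?thesis
    using assms by (auto simp: is_hom_def map_query_def graph_of_def wf_query_def)
qed

lemma wf_query_Exp:
  assumes "wf_query Q" "E \<in> Exp Q"
  shows "wf_query E"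
proof -
  obtain ws where E: "E = collapse (eq_atoms Q ws) (pre_expansion Q ws)"
    using assms(2) by (auto simp: Exp_def)
  have "x \<in> qvars Q" "y \<in> qvars Q" if "i < length (atoms Q)" "atoms Q ! i = (x, r, y)" for i x r y
    using assms(1) nth_mem[OF that(1)] that(2) by (auto simp: wf_query_def)
  then have "wf_query (pre_expansion Q ws)"
    unfolding wf_query_def
    using assms(1)
    by (auto simp: mem_atoms_pre_expansion) (auto simp: pre_expansion_def exp_var_def wf_query_def)
  then show ?thesis unfolding E collapse_def by (rule wf_query_map_query)
qed

lemma finite_qvars_Exp:
  assumes "finite (qvars Q)" "E \<in> Exp Q"
  shows "finite (qvars E)"
proof -
  have "finite {Fresh i j | i j. i < length (atoms Q) \<and> 0 < j \<and> j < length (ws ! i)}" for ws :: "'b list list"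
    by (rule finite_subset[of _ "\<Union>i < length (atoms Q). Fresh i ` {..<length (ws ! i)}"]) auto
  then have "finite (qvars (pre_expansion Q ws))" for ws :: "'b list list"
    using assms(1) by (simp add: pre_expansion_def)
  then show ?thesis
    using assms(2) by (auto simp: Exp_def collapse_def map_query_def)
qed

theorem proposition4p3:
  fixes Q\<^sub>1 Q\<^sub>2 :: "('v, 'a::finite rexp) query"
  assumes "crpq Q\<^sub>1" and "crpq Q\<^sub>2"
  shows "qinj_contained TYPE('n::infinite) Q\<^sub>1 Q\<^sub>2 \<longleftrightarrow>
    (\<forall>E\<^sub>1 \<in> Exp Q\<^sub>1. \<exists>E\<^sub>2 \<in> Exp Q\<^sub>2. inj_hom E\<^sub>2 E\<^sub>1)"
proof
  note eval = mem_qinj_eval_iff[OF wf_query_if_crpq]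
  assume contained: "qinj_contained TYPE('n) Q\<^sub>1 Q\<^sub>2"
  show "\<forall>E\<^sub>1 \<in> Exp Q\<^sub>1. \<exists>E\<^sub>2 \<in> Exp Q\<^sub>2. inj_hom E\<^sub>2 E\<^sub>1"
  proof
    fix E\<^sub>1 assume E\<^sub>1: "E\<^sub>1 \<in> Exp Q\<^sub>1"
    have "finite (qvars Q\<^sub>1)" using assms(1) by (auto simp: crpq_def)
    then have fin: "finite (qvars E\<^sub>1)" using E\<^sub>1 by (rule finite_qvars_Exp)
    have wf: "wf_query E\<^sub>1" using wf_query_if_crpq[OF assms(1)] E\<^sub>1 by (rule wf_query_Exp)
    \<comment> \<open>The variables of the expansion are classes, while nodes must have type
      \<open>'n\<close>; an infinite type has room for an injective copy of the finitely many
      variables.\<close>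
    obtain f :: "'v evar set \<Rightarrow> 'n" where f: "inj_on f (qvars E\<^sub>1)"
      using infinite_arbitrarily_large[OF infinite_UNIV, of "card (qvars E\<^sub>1)"] fin
      by (metis finite_same_card_bij bij_betw_imp_inj_on)
    define G where "G = graph_of (map_query f id E\<^sub>1)"
    have "wf_graph_db G"
      using wf_query_map_query[OF wf, of f id] fin
      by (auto simp: wf_graph_db_def G_def graph_of_def wf_query_def) (simp add: map_query_def)
    \<comment> \<open>The renaming itself witnesses that the expansion maps injectively into its
      copy.\<close>
    moreover have "is_hom f E\<^sub>1 G (map f (free E\<^sub>1))"
      by (force simp: is_hom_def G_def graph_of_def map_query_def)
    then have "map f (free E\<^sub>1) \<in> qinj_eval Q\<^sub>1 G"
      using E\<^sub>1 f eval[OF assms(1)] by blast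
    ultimately have "map f (free E\<^sub>1) \<in> qinj_eval Q\<^sub>2 G"
      using contained by (auto simp: qinj_contained_def)
    then obtain E\<^sub>2 g where E\<^sub>2: "E\<^sub>2 \<in> Exp Q\<^sub>2"
      and g: "is_hom g E\<^sub>2 G (map f (free E\<^sub>1))" "inj_on g (qvars E\<^sub>2)"
      using eval[OF assms(2)] by blast
    let ?f' = "inv_into (qvars E\<^sub>1) f"
    have "is_hom (?f' \<circ> g) E\<^sub>2 (graph_of E\<^sub>1) (free E\<^sub>1)"
      using is_hom_graph_of_comp[OF _ is_hom_inv_into[OF wf f]] g(1)
      by (simp add: G_def map_query_def)
    \<comment> \<open>\<open>inv_into\<close> is injective only on the image of \<open>f\<close>, so
      the range of \<open>g\<close> has to lie there.\<close>
    moreover have "g ` qvars E\<^sub>2 \<subseteq> f ` qvars E\<^sub>1"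
      using g(1) by (simp add: is_hom_def G_def graph_of_def map_query_def)
    then have "inj_on (?f' \<circ> g) (qvars E\<^sub>2)"
      using g(2) by (intro comp_inj_on inj_on_inv_into)
    ultimately show "\<exists>E\<^sub>2 \<in> Exp Q\<^sub>2. inj_hom E\<^sub>2 E\<^sub>1"
      using E\<^sub>2 unfolding inj_hom_def by blast
  qed
next
  note eval = mem_qinj_eval_iff[OF wf_query_if_crpq]
  assume homs: "\<forall>E\<^sub>1 \<in> Exp Q\<^sub>1. \<exists>E\<^sub>2 \<in> Exp Q\<^sub>2. inj_hom E\<^sub>2 E\<^sub>1"
  have "vs \<in> qinj_eval Q\<^sub>2 G" if vs: "vs \<in> qinj_eval Q\<^sub>1 G" for vs and G :: "('n, 'a) graph_db"
  proof -
    obtain E\<^sub>1 h where E\<^sub>1: "E\<^sub>1 \<in> Exp Q\<^sub>1" and h: "is_hom h E\<^sub>1 G vs" "inj_on h (qvars E\<^sub>1)"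
      using vs eval[OF assms(1)] by blast
    obtain E\<^sub>2 g where E\<^sub>2: "E\<^sub>2 \<in> Exp Q\<^sub>2"
      and g: "is_hom g E\<^sub>2 (graph_of E\<^sub>1) (free E\<^sub>1)" "inj_on g (qvars E\<^sub>2)"
      using homs E\<^sub>1 by (auto simp: inj_hom_def)
    have "g ` qvars E\<^sub>2 \<subseteq> qvars E\<^sub>1" using g(1) by (simp add: is_hom_def graph_of_def)
    then have "inj_on (h \<circ> g) (qvars E\<^sub>2)"
      using g(2) h(2) by (meson comp_inj_on inj_on_subset)
    then show ?thesis
      using is_hom_graph_of_comp[OF g(1) h(1)] E\<^sub>2 eval[OF assms(2)] by blast
  qed
  then show "qinj_contained TYPE('n) Q\<^sub>1 Q\<^sub>2"
    by (auto simp: qinj_contained_def)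
qed

end
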